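(* Let $d\ge1$ and $1\le m\le\binom{d+2}{2}$. Consider the following procedure: form the set of all polynomials $\sum_{\mu\in S}\mu$, where $S$ runs over all $m$-element subsets of the set of monomials of degree $d$ in $x,y,z$; partition this set into equivalence classes for the relation $g\sim h$ if and only if $g$ lies in the $\mathfrak S_3$-orbit of $h$; from each equivalence class select its first element with respect to the ordering of polynomials. Then the list of selected polynomials is the list of the elements of $\mathscr T_m$.
   Context: The symmetric group $\mathfrak S_3$ acts on polynomials in $x,y,z$ by permuting the variables. Let $\mathscr A$ be the set of homogeneous polynomials of degree $d$ in the $n=3$ variables $x,y,z$ all of whose nonzero coefficients are equal to $1$. Ordering: $x\prec y\prec z$. Monomials of the same degree are compared lexicographically, comparing first the exponent of $z$, then that of $y$, then that of $x$ (e.g. for degree $2$: $x^2\prec xy\prec y^2\prec xz\prec yz\prec z^2$). Two polynomials in $\mathscr A$ with the same number of terms are compared lexicographically by their lists of monomials, each written in decreasing order. $\mathscr T$ is the set of representatives of the $\mathfrak S_3$-orbits in $\mathscr A$ in which each element is the minimum in its orbit according to this lexicographic order, and $\mathscr T_m\subset\mathscr T$ is the subset of elements having exactly $m$ terms. *)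

theory Defs
  imports "HOL-Library.Poly_Mapping"
begin

datatype var = var_x | var_y | var_z

text \<open>A monomial is given by its exponents. A polynomial maps monomials to coefficients,
  in an arbitrary nontrivial commutative ring.\<close>

type_synonym mon = "var \<Rightarrow>\<^sub>0 nat"
type_synonym 'a polyn = "mon \<Rightarrow>\<^sub>0 'a"

abbreviation mon_poly :: "mon \<Rightarrow> 'a::comm_ring_1 polyn" where
  "mon_poly \<mu> \<equiv> Poly_Mapping.single \<mu> 1"

definition mdeg :: "mon \<Rightarrow> nat" where
  "mdeg \<mu> = Poly_Mapping.lookup \<mu> var_x + Poly_Mapping.lookup \<mu> var_y + Poly_Mapping.lookup \<mu> var_z"

definition monomials :: "nat \<Rightarrow> mon set" where
  "monomials d = {\<mu>. mdeg \<mu> = d}"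

definition homogeneous :: "nat \<Rightarrow> 'a::comm_ring_1 polyn \<Rightarrow> bool" where
  "homogeneous d f \<longleftrightarrow> (\<forall>\<mu>\<in>Poly_Mapping.keys f. mdeg \<mu> = d)"

abbreviation num_terms :: "'a::comm_ring_1 polyn \<Rightarrow> nat" where
  "num_terms f \<equiv> card (Poly_Mapping.keys f)"

text \<open>The zero polynomial is homogeneous of every degree, so it belongs to each
  \<open>polys_A d\<close>; it has no terms.\<close>

definition polys_A :: "nat \<Rightarrow> 'a::comm_ring_1 polyn set" where
  "polys_A d = {f. homogeneous d f \<and> (\<forall>\<mu>. Poly_Mapping.lookup f \<mu> \<noteq> 0 \<longrightarrow> Poly_Mapping.lookup f \<mu> = 1)}"

text \<open>The substitution of \<open>\<sigma> v\<close> for each variable \<open>v\<close>, on monomials and on polynomials.\<close>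

definition permute_mon :: "(var \<Rightarrow> var) \<Rightarrow> mon \<Rightarrow> mon" where
  "permute_mon \<sigma> \<mu> = (\<Sum>v\<in>Poly_Mapping.keys \<mu>. Poly_Mapping.single (\<sigma> v) (Poly_Mapping.lookup \<mu> v))"

definition permute_poly :: "(var \<Rightarrow> var) \<Rightarrow> 'a::comm_ring_1 polyn \<Rightarrow> 'a polyn" where
  "permute_poly \<sigma> f = (\<Sum>\<mu>\<in>Poly_Mapping.keys f. Poly_Mapping.single (permute_mon \<sigma> \<mu>) (Poly_Mapping.lookup f \<mu>))"

definition S3_orbit :: "'a::comm_ring_1 polyn \<Rightarrow> 'a polyn set" where
  "S3_orbit f = {permute_poly \<sigma> f | \<sigma>. bij \<sigma>}"

definition mon_less :: "mon \<Rightarrow> mon \<Rightarrow> bool" (infix "\<prec>\<^sub>m" 50) where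
  "\<mu> \<prec>\<^sub>m \<nu> \<longleftrightarrow>
     Poly_Mapping.lookup \<mu> var_z < Poly_Mapping.lookup \<nu> var_z \<or>
     Poly_Mapping.lookup \<mu> var_z = Poly_Mapping.lookup \<nu> var_z \<and>
       (Poly_Mapping.lookup \<mu> var_y < Poly_Mapping.lookup \<nu> var_y \<or>
        Poly_Mapping.lookup \<mu> var_y = Poly_Mapping.lookup \<nu> var_y \<and> Poly_Mapping.lookup \<mu> var_x < Poly_Mapping.lookup \<nu> var_x)"

definition mon_list :: "'a::comm_ring_1 polyn \<Rightarrow> mon list" where
  "mon_list f = (THE ms. sorted_wrt (\<lambda>\<mu> \<nu>. \<nu> \<prec>\<^sub>m \<mu>) ms \<and> set ms = Poly_Mapping.keys f)"

text \<open>\<^const>\<open>lex\<close> only relates lists of equal length, so only polynomials with the same number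
  of terms are compared.\<close>

definition poly_less :: "'a::comm_ring_1 polyn \<Rightarrow> 'a polyn \<Rightarrow> bool" (infix "\<prec>\<^sub>p" 50) where
  "f \<prec>\<^sub>p g \<longleftrightarrow> (mon_list f, mon_list g) \<in> lex {(\<mu>, \<nu>). \<mu> \<prec>\<^sub>m \<nu>}"

definition is_first :: "'a::comm_ring_1 polyn \<Rightarrow> 'a polyn set \<Rightarrow> bool" where
  "is_first f C \<longleftrightarrow> f \<in> C \<and> (\<forall>g\<in>C. g \<noteq> f \<longrightarrow> f \<prec>\<^sub>p g)"

definition polys_T :: "nat \<Rightarrow> 'a::comm_ring_1 polyn set" where
  "polys_T d = {f \<in> polys_A d. is_first f (S3_orbit f)}"

definition polys_Tm :: "nat \<Rightarrow> nat \<Rightarrow> 'a::comm_ring_1 polyn set" where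
  "polys_Tm d m = {f \<in> polys_T d. num_terms f = m}"

definition subset_sums :: "nat \<Rightarrow> nat \<Rightarrow> 'a::comm_ring_1 polyn set" where
  "subset_sums d m = {\<Sum>\<mu>\<in>S. mon_poly \<mu> | S. S \<subseteq> monomials d \<and> card S = m}"

definition orbit_rel :: "nat \<Rightarrow> nat \<Rightarrow> ('a::comm_ring_1 polyn \<times> 'a polyn) set" where
  "orbit_rel d m =
     {(g, h). g \<in> subset_sums d m \<and> h \<in> subset_sums d m \<and> g \<in> S3_orbit h}"

definition poly_classes :: "nat \<Rightarrow> nat \<Rightarrow> 'a::comm_ring_1 polyn set set" where
  "poly_classes d m = subset_sums d m // orbit_rel d m"

definition first_of :: "'a::comm_ring_1 polyn set \<Rightarrow> 'a polyn" where
  "first_of C = (THE f. is_first f C)"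

lemma mon_eqI:
  "Poly_Mapping.lookup \<mu> var_x = Poly_Mapping.lookup \<nu> var_x \<Longrightarrow> Poly_Mapping.lookup \<mu> var_y = Poly_Mapping.lookup \<nu> var_y \<Longrightarrow>
   Poly_Mapping.lookup \<mu> var_z = Poly_Mapping.lookup \<nu> var_z \<Longrightarrow> \<mu> = (\<nu> :: mon)"
  by (rule poly_mapping_eqI) (metis var.exhaust)

lemma mon_less_linorder: "class.linorder (\<lambda>\<mu> \<nu>. \<mu> = \<nu> \<or> \<mu> \<prec>\<^sub>m \<nu>) (\<prec>\<^sub>m)"
  by unfold_locales (auto simp: mon_less_def intro: mon_eqI)

text \<open>The description defining \<^const>\<open>mon_list\<close> is uniquely satisfiable.\<close>

lemma mon_list_ex1:
  "\<exists>!ms. sorted_wrt (\<lambda>\<mu> \<nu>. \<nu> \<prec>\<^sub>m \<mu>) ms \<and> set ms = Poly_Mapping.keys (f :: 'a::comm_ring_1 polyn)"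
proof -
  interpret L: linorder "\<lambda>\<mu> \<nu>. \<mu> = \<nu> \<or> \<mu> \<prec>\<^sub>m \<nu>" "(\<prec>\<^sub>m)" by (rule mon_less_linorder)
  have "\<exists>!l. sorted_wrt (\<prec>\<^sub>m) l \<and> set l = Poly_Mapping.keys f"
    using L.finite_sorted_distinct_unique[of "Poly_Mapping.keys f"] by (simp add: L.strict_sorted_iff) (metis (no_types, lifting))
  then obtain l where l: "sorted_wrt (\<prec>\<^sub>m) l" "set l = Poly_Mapping.keys f"
    and u: "\<And>k. sorted_wrt (\<prec>\<^sub>m) k \<Longrightarrow> set k = Poly_Mapping.keys f \<Longrightarrow> k = l" by metis
  show ?thesis
  proof (rule ex1I[of _ "rev l"])
    show "sorted_wrt (\<lambda>\<mu> \<nu>. \<nu> \<prec>\<^sub>m \<mu>) (rev l) \<and> set (rev l) = Poly_Mapping.keys f"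
      using l by (simp add: sorted_wrt_rev)
    fix ms assume "sorted_wrt (\<lambda>\<mu> \<nu>. \<nu> \<prec>\<^sub>m \<mu>) ms \<and> set ms = Poly_Mapping.keys f"
    then have "rev ms = l" by (intro u) (auto simp: sorted_wrt_rev)
    then show "ms = rev l" by auto
  qed
qed

end

theory Submission
  imports Defs
begin

text \<open>
  An element of \<open>\<A>\<close> is determined by its set of monomials, and any finite set of degree-\<open>d\<close>
  monomials occurs. Hence the sums over \<open>m\<close>-element sets of monomials are exactly the elements
  of \<open>\<A>\<close> with \<open>m\<close> terms (\<open>subset_sums_eq\<close>). Permuting the variables preserves the degree of
  a monomial and permutes the coefficients of a polynomial, so this set is a union of whole
  \<open>S\<^sub>3\<close>-orbits, and the classes of the relation \<open>\<sim>\<close> on it are full orbits rather than mere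
  traces of orbits (\<open>poly_classes_eq\<close>). The first element of a class is therefore the minimum
  of its own orbit, which is the condition for membership in \<open>\<T>\<^sub>m\<close>; conversely, an element
  of \<open>\<T>\<^sub>m\<close> is the first element of the class that is its orbit. Distinct classes are disjoint
  and so select distinct polynomials.

  That each class has a first element at all is because the order is a strict linear order on
  polynomials of \<open>\<A>\<close> with a common number of terms (\<open>poly_less_strict_linear\<close>), and there are
  only finitely many of these.
\<close>

section \<open>Relabelling the index set of a finitely supported function\<close>

text \<open>Both the action on monomials and the action on polynomials are instances of this one
  construction, at the levels of variables and of monomials respectively, so that the group
  action laws need to be proved only once.\<close>

definition pushforward :: "('a \<Rightarrow> 'b) \<Rightarrow> ('a \<Rightarrow>\<^sub>0 'c) \<Rightarrow> ('b \<Rightarrow>\<^sub>0 'c::comm_monoid_add)" where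
  "pushforward g f =
     (\<Sum>k\<in>Poly_Mapping.keys f. Poly_Mapping.single (g k) (Poly_Mapping.lookup f k))"

lemma lookup_pushforward:
  assumes "inj g"
  shows "Poly_Mapping.lookup (pushforward g f) (g k) = Poly_Mapping.lookup f k"
proof -
  have "Poly_Mapping.lookup (pushforward g f) (g k) =
      (\<Sum>j\<in>Poly_Mapping.keys f. if j = k then Poly_Mapping.lookup f j else 0)"
    using assms
    by (auto simp: pushforward_def lookup_sum lookup_single when_def inj_eq intro!: sum.cong)
  then show ?thesis
    by (simp add: in_keys_iff)
qed

lemma pushforward_id: "pushforward id = id"
proof (intro ext poly_mapping_eqI)
  fix f :: "'a \<Rightarrow>\<^sub>0 'b::comm_monoid_add" and k
  show "Poly_Mapping.lookup (pushforward id f) k = Poly_Mapping.lookup (id f) k"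
    using lookup_pushforward[of id f k] by simp
qed

text \<open>By bijectivity every index has the form \<open>g (h k)\<close>, and at such an index both sides
  have the value of \<open>f\<close> at \<open>k\<close>.\<close>

lemma pushforward_comp:
  assumes "bij g" "bij h"
  shows "pushforward g (pushforward h f) = pushforward (g \<circ> h) f"
proof (rule poly_mapping_eqI)
  fix j
  obtain k where j: "j = g (h k)"
    using assms by (metis bij_pointE)
  show "Poly_Mapping.lookup (pushforward g (pushforward h f)) j =
      Poly_Mapping.lookup (pushforward (g \<circ> h) f) j"
    using lookup_pushforward[of "g \<circ> h" f k] assms
    by (simp add: j lookup_pushforward bij_is_inj inj_compose)
qed

lemma keys_pushforward:
  assumes "bij g"
  shows "Poly_Mapping.keys (pushforward g f) = g ` Poly_Mapping.keys f"
proof (rule set_eqI)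
  fix j
  obtain k where j: "j = g k"
    using assms by (metis bij_pointE)
  show "j \<in> Poly_Mapping.keys (pushforward g f) \<longleftrightarrow> j \<in> g ` Poly_Mapping.keys f"
    using assms by (simp add: j in_keys_iff lookup_pushforward bij_is_inj inj_image_mem_iff)
qed

lemma bij_pushforward:
  assumes "bij g"
  shows "bij (pushforward g :: ('a \<Rightarrow>\<^sub>0 'c::comm_monoid_add) \<Rightarrow> _)"
proof (rule o_bij)
  show "pushforward (inv g) \<circ> pushforward g = (id :: ('a \<Rightarrow>\<^sub>0 'c) \<Rightarrow> _)"
    using assms by (simp add: fun_eq_iff pushforward_comp bij_imp_bij_inv bij_is_inj
        pushforward_id)
  show "pushforward g \<circ> pushforward (inv g) = id"
    using assms by (simp add: fun_eq_iff pushforward_comp bij_imp_bij_inv bij_is_surj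
        surj_iff[THEN iffD1] pushforward_id)
qed

section \<open>The action of the symmetric group\<close>

lemma permute_mon_eq_pushforward: "permute_mon \<sigma> = pushforward \<sigma>"
  by (simp add: fun_eq_iff permute_mon_def pushforward_def)

lemma permute_poly_eq_pushforward: "permute_poly \<sigma> = pushforward (permute_mon \<sigma>)"
  by (simp add: fun_eq_iff permute_poly_def pushforward_def)

lemma bij_permute_mon: "bij \<sigma> \<Longrightarrow> bij (permute_mon \<sigma>)"
  by (simp add: permute_mon_eq_pushforward bij_pushforward)

lemma permute_poly_id: "permute_poly id f = f"
  by (simp add: permute_poly_eq_pushforward permute_mon_eq_pushforward pushforward_id)

lemma permute_poly_comp:
  assumes "bij \<sigma>" "bij \<tau>"
  shows "permute_poly \<sigma> (permute_poly \<tau> f) = permute_poly (\<sigma> \<circ> \<tau>) f"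
proof -
  have "permute_mon \<sigma> \<circ> permute_mon \<tau> = permute_mon (\<sigma> \<circ> \<tau>)"
    using assms by (simp add: fun_eq_iff permute_mon_eq_pushforward pushforward_comp)
  then show ?thesis
    using assms by (simp add: permute_poly_eq_pushforward pushforward_comp bij_permute_mon)
qed

lemma S3_orbit_refl: "f \<in> S3_orbit f"
  unfolding S3_orbit_def using permute_poly_id[of f] by (metis (mono_tags, lifting) bij_id mem_Collect_eq)

lemma S3_orbit_sym:
  assumes "g \<in> S3_orbit f"
  shows "f \<in> S3_orbit g"
proof -
  obtain \<sigma> where \<sigma>: "bij \<sigma>" "g = permute_poly \<sigma> f"
    using assms by (auto simp: S3_orbit_def)
  then have "permute_poly (inv \<sigma>) g = f"
    by (simp add: permute_poly_comp bij_imp_bij_inv bij_is_inj permute_poly_id)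
  then show ?thesis
    using \<sigma> bij_imp_bij_inv by (force simp: S3_orbit_def)
qed

lemma S3_orbit_trans:
  assumes "h \<in> S3_orbit g" "g \<in> S3_orbit f"
  shows "h \<in> S3_orbit f"
proof -
  obtain \<sigma> \<tau> where "bij \<sigma>" "bij \<tau>" "g = permute_poly \<sigma> f" "h = permute_poly \<tau> g"
    using assms by (auto simp: S3_orbit_def)
  then show ?thesis
    by (auto simp: S3_orbit_def permute_poly_comp intro!: bij_comp)
qed

lemma S3_orbit_eq: "g \<in> S3_orbit f \<Longrightarrow> S3_orbit g = S3_orbit f"
  by (meson S3_orbit_sym S3_orbit_trans subsetI subset_antisym)

lemma UNIV_var: "(UNIV :: var set) = {var_x, var_y, var_z}"
  using var.exhaust by auto

text \<open>The degree is the sum of the exponents over all variables, and a sum is invariant under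
  reindexing by a bijection.\<close>

lemma mdeg_permute_mon:
  assumes "bij \<sigma>"
  shows "mdeg (permute_mon \<sigma> \<mu>) = mdeg \<mu>"
proof -
  have mdeg: "mdeg \<nu> = (\<Sum>v\<in>UNIV. Poly_Mapping.lookup \<nu> v)" for \<nu>
    by (simp add: UNIV_var mdeg_def)
  have "(\<Sum>v\<in>UNIV. Poly_Mapping.lookup (permute_mon \<sigma> \<mu>) v) =
      (\<Sum>v\<in>UNIV. Poly_Mapping.lookup (permute_mon \<sigma> \<mu>) (\<sigma> v))"
    using sum.reindex_bij_betw[OF assms, of "Poly_Mapping.lookup (permute_mon \<sigma> \<mu>)"] by simp
  then show ?thesis
    using assms by (simp add: mdeg permute_mon_eq_pushforward lookup_pushforward bij_is_inj)
qed

lemma permute_poly_in_polys_A: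
  assumes "bij \<sigma>" "f \<in> polys_A d"
  shows "permute_poly \<sigma> f \<in> polys_A d"
proof -
  have "Poly_Mapping.lookup (permute_poly \<sigma> f) \<nu> = 1"
    if nz: "Poly_Mapping.lookup (permute_poly \<sigma> f) \<nu> \<noteq> 0" for \<nu>
  proof -
    obtain \<mu> where "\<nu> = permute_mon \<sigma> \<mu>"
      using bij_permute_mon[OF assms(1)] by (metis bij_pointE)
    then show ?thesis
      using nz assms bij_permute_mon[OF assms(1)]
      by (simp add: permute_poly_eq_pushforward lookup_pushforward bij_is_inj polys_A_def)
  qed
  then show ?thesis
    using assms by (auto simp: polys_A_def homogeneous_def permute_poly_eq_pushforward
        keys_pushforward bij_permute_mon mdeg_permute_mon)
qed

lemma num_terms_permute_poly: "bij \<sigma> \<Longrightarrow> num_terms (permute_poly \<sigma> f) = num_terms f"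
  by (simp add: permute_poly_eq_pushforward keys_pushforward bij_permute_mon bij_is_inj
      card_image inj_on_subset[OF bij_is_inj])

section \<open>Sums over sets of monomials\<close>

lemma finite_monomials: "finite (monomials d)"
proof (rule inj_on_finite)
  let ?e = "\<lambda>\<mu>::mon. (Poly_Mapping.lookup \<mu> var_x, Poly_Mapping.lookup \<mu> var_y,
    Poly_Mapping.lookup \<mu> var_z)"
  show "inj_on ?e (monomials d)"
    by (rule inj_onI) (auto intro: mon_eqI)
  show "?e ` monomials d \<subseteq> {..d} \<times> {..d} \<times> {..d}"
    by (auto simp: monomials_def mdeg_def)
qed simp

lemma lookup_sum_mon_poly:
  "finite S \<Longrightarrow> Poly_Mapping.lookup (\<Sum>\<mu>\<in>S. mon_poly \<mu> :: 'a::comm_ring_1 polyn) \<nu> =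
     (if \<nu> \<in> S then 1 else 0)"
  by (simp add: lookup_sum lookup_single when_def)

lemma keys_sum_mon_poly:
  "finite S \<Longrightarrow> Poly_Mapping.keys (\<Sum>\<mu>\<in>S. mon_poly \<mu> :: 'a::comm_ring_1 polyn) = S"
  by (auto simp: in_keys_iff lookup_sum_mon_poly split: if_splits)

lemma polys_A_eq_sum:
  assumes "f \<in> polys_A d"
  shows "f = (\<Sum>\<mu>\<in>Poly_Mapping.keys f. mon_poly \<mu>)"
  using assms
  by (intro poly_mapping_eqI) (auto simp: lookup_sum_mon_poly polys_A_def in_keys_iff)

text \<open>A polynomial in \<open>\<A>\<close> is the sum over its own support, so taking supports and summing are
  mutually inverse; the number of terms is the size of the set.\<close>

lemma subset_sums_eq: "subset_sums d m = {f \<in> polys_A d. num_terms f = m}"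
proof (intro equalityI subsetI)
  fix f :: "'a::comm_ring_1 polyn"
  assume "f \<in> subset_sums d m"
  then obtain S where S: "f = (\<Sum>\<mu>\<in>S. mon_poly \<mu>)" "S \<subseteq> monomials d" "card S = m"
    by (auto simp: subset_sums_def)
  moreover have "finite S"
    using S(2) finite_monomials finite_subset by blast
  ultimately show "f \<in> {f \<in> polys_A d. num_terms f = m}"
    by (auto simp: polys_A_def homogeneous_def keys_sum_mon_poly lookup_sum_mon_poly
        monomials_def)
next
  fix f :: "'a::comm_ring_1 polyn"
  assume f: "f \<in> {f \<in> polys_A d. num_terms f = m}"
  then have "Poly_Mapping.keys f \<subseteq> monomials d"
    by (auto simp: polys_A_def homogeneous_def monomials_def)
  then show "f \<in> subset_sums d m"
    using f polys_A_eq_sum[of f d] unfolding subset_sums_def by blast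
qed

lemma finite_subset_sums: "finite (subset_sums d m :: 'a::comm_ring_1 polyn set)"
proof -
  have "subset_sums d m \<subseteq> (\<lambda>S. \<Sum>\<mu>\<in>S. mon_poly \<mu> :: 'a polyn) ` Pow (monomials d)"
    by (auto simp: subset_sums_def)
  then show ?thesis
    using finite_monomials finite_subset by blast
qed

lemma S3_orbit_subset_sums: "f \<in> subset_sums d m \<Longrightarrow> S3_orbit f \<subseteq> subset_sums d m"
  by (auto simp: S3_orbit_def subset_sums_eq permute_poly_in_polys_A num_terms_permute_poly)

section \<open>The equivalence classes\<close>

lemma equiv_orbit_rel: "equiv (subset_sums d m) (orbit_rel d m)"
proof (rule equivI)
  show "orbit_rel d m \<subseteq> subset_sums d m \<times> subset_sums d m"
    by (auto simp: orbit_rel_def)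
  show "refl_on (subset_sums d m) (orbit_rel d m)"
    by (auto simp: refl_on_def orbit_rel_def S3_orbit_refl)
  show "sym (orbit_rel d m)"
    by (auto simp: sym_def orbit_rel_def S3_orbit_sym)
  show "trans (orbit_rel d m)"
    unfolding trans_def orbit_rel_def using S3_orbit_trans by blast
qed

text \<open>The relation is restricted to \<open>m\<close>-term sums, but this restriction cuts nothing off an
  orbit, since the orbit of an \<open>m\<close>-term sum consists of \<open>m\<close>-term sums.\<close>

lemma poly_classes_eq: "poly_classes d m = S3_orbit ` subset_sums d m"
proof -
  have "orbit_rel d m `` {f} = S3_orbit f" if "f \<in> subset_sums d m" for f :: "'a::comm_ring_1 polyn"
    using that S3_orbit_subset_sums[OF that] S3_orbit_sym by (fastforce simp: orbit_rel_def)
  then show ?thesis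
    by (auto simp: poly_classes_def quotient_def)
qed

lemma poly_class_eq_orbit:
  "C \<in> poly_classes d m \<Longrightarrow> f \<in> C \<Longrightarrow> f \<in> subset_sums d m \<and> S3_orbit f = C"
  using S3_orbit_subset_sums S3_orbit_eq by (fastforce simp: poly_classes_eq)

section \<open>The ordering of polynomials\<close>

lemma mon_list:
  "sorted_wrt (\<lambda>\<mu> \<nu>. \<nu> \<prec>\<^sub>m \<mu>) (mon_list f)" "set (mon_list f) = Poly_Mapping.keys f"
  using theI'[OF mon_list_ex1[of f]] by (simp_all add: mon_list_def)

lemma length_mon_list: "length (mon_list f) = num_terms f"
proof -
  have "sorted_wrt (\<lambda>\<mu> \<nu>. \<nu> \<prec>\<^sub>m \<mu>) ms \<Longrightarrow> distinct ms" for ms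
    by (induction ms) (auto simp: mon_less_def)
  then show ?thesis
    by (metis mon_list distinct_card)
qed

text \<open>Asymmetry and transitivity are inherited from the lexicographic order on lists. Totality
  has two ingredients: the lists to be compared have the same length, and a polynomial in \<open>\<A>\<close>
  can be recovered from its list, because all coefficients are known to be 1.\<close>

lemma poly_less_strict_linear:
  fixes d m :: nat
  defines "A \<equiv> subset_sums d m :: 'a::comm_ring_1 polyn set"
  shows "asymp_on A (\<prec>\<^sub>p)" "transp_on A (\<prec>\<^sub>p)" "totalp_on A (\<prec>\<^sub>p)"
proof -
  let ?r = "{(\<mu>, \<nu>). \<mu> \<prec>\<^sub>m \<nu>}"
  have asym: "asym ?r" and trans: "trans ?r" and total: "\<forall>\<mu> \<nu>. (\<mu>, \<nu>) \<in> ?r \<or> \<mu> = \<nu> \<or> (\<nu>, \<mu>) \<in> ?r"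
    by (auto simp: mon_less_def asym_on_def trans_def intro: mon_eqI)
  show "asymp_on A (\<prec>\<^sub>p)"
    using asym by (auto simp: asymp_on_def poly_less_def lexord_lex dest: lexord_asym[THEN asymD])
  show "transp_on A (\<prec>\<^sub>p)"
    using trans by (auto simp: transp_on_def poly_less_def lexord_lex intro: lexord_trans)
  show "totalp_on A (\<prec>\<^sub>p)"
  proof (rule totalp_onI)
    fix f g
    assume fg: "f \<in> A" "g \<in> A" "f \<noteq> g"
    then have "Poly_Mapping.keys f \<noteq> Poly_Mapping.keys g"
      using polys_A_eq_sum[of f d] polys_A_eq_sum[of g d]
      by (auto simp: A_def subset_sums_eq)
    then have "mon_list f \<noteq> mon_list g"
      by (metis mon_list(2))
    moreover have "length (mon_list f) = length (mon_list g)"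
      using fg by (simp add: A_def subset_sums_eq length_mon_list)
    ultimately show "f \<prec>\<^sub>p g \<or> g \<prec>\<^sub>p f"
      using lexord_linear[OF total, of "mon_list f" "mon_list g"]
      by (auto simp: poly_less_def lexord_lex)
  qed
qed

lemma ex1_is_first:
  fixes C :: "'a::comm_ring_1 polyn set"
  assumes "C \<subseteq> subset_sums d m" "C \<noteq> {}"
  shows "\<exists>!f. is_first f C"
proof -
  note order = poly_less_strict_linear[of d m, where ?'a = 'a]
  have asym: "asymp_on C (\<prec>\<^sub>p)" and "transp_on C (\<prec>\<^sub>p)" "totalp_on C (\<prec>\<^sub>p)"
    using order assms(1) by (blast intro: asymp_on_subset transp_on_subset totalp_on_subset)+
  moreover have "finite C"
    using assms(1) finite_subset_sums finite_subset by blast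
  ultimately obtain f where "is_first f C"
    using Finite_Set.bex_least_element[of C "(\<prec>\<^sub>p)"] assms(2) by (auto simp: is_first_def)
  then show ?thesis
    using asym by (metis asymp_onD is_first_def)
qed

section \<open>Correctness of the procedure\<close>

theorem proposition5p1:
  fixes d m :: nat
  assumes "d \<ge> 1" and "1 \<le> m" and "m \<le> (d + 2) choose 2"
  shows "equiv (subset_sums d m :: 'a::comm_ring_1 polyn set) (orbit_rel d m)
    \<and> finite (poly_classes d m :: 'a polyn set set)
    \<and> (\<forall>C \<in> (poly_classes d m :: 'a polyn set set). \<exists>!f. is_first f C)
    \<and> (\<forall>Cs :: 'a polyn set list. distinct Cs \<and> set Cs = poly_classes d m \<longrightarrow>
         distinct (map first_of Cs) \<and> set (map first_of Cs) = polys_Tm d m)"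
proof -
  let ?Q = "poly_classes d m :: 'a polyn set set"
  have ex1: "\<exists>!f. is_first f C" if "C \<in> ?Q" for C
  proof (rule ex1_is_first)
    show "C \<subseteq> subset_sums d m"
      using that S3_orbit_subset_sums by (auto simp: poly_classes_eq)
    show "C \<noteq> {}"
      using that S3_orbit_refl by (fastforce simp: poly_classes_eq)
  qed
  have first: "is_first (first_of C) C" if "C \<in> ?Q" for C
    unfolding first_of_def by (rule theI'[OF ex1[OF that]])
  have orbit: "S3_orbit (first_of C) = C" "first_of C \<in> subset_sums d m" if "C \<in> ?Q" for C
    using first[OF that] poly_class_eq_orbit[OF that] by (auto simp: is_first_def)
  \<comment> \<open>A class can be recovered from its first element, as the orbit of that element.\<close>
  have inj: "inj_on first_of ?Q"
    by (rule inj_onI) (metis orbit(1))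
  have image: "first_of ` ?Q = polys_Tm d m"
  proof (intro equalityI subsetI)
    fix f
    assume "f \<in> first_of ` ?Q"
    then obtain C where "C \<in> ?Q" "f = first_of C"
      by blast
    then show "f \<in> polys_Tm d m"
      using first[of C] orbit[of C] by (simp add: polys_Tm_def polys_T_def subset_sums_eq)
  next
    fix f :: "'a polyn"
    assume f: "f \<in> polys_Tm d m"
    then have "S3_orbit f \<in> ?Q"
      by (auto simp: polys_Tm_def polys_T_def poly_classes_eq subset_sums_eq)
    moreover from this have "first_of (S3_orbit f) = f"
      using f ex1 first by (metis (no_types, lifting) polys_Tm_def polys_T_def mem_Collect_eq)
    ultimately show "f \<in> first_of ` ?Q"
      by (metis image_eqI)
  qed
  have "finite ?Q"
    by (simp add: poly_classes_eq finite_subset_sums)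
  then show ?thesis
    using equiv_orbit_rel ex1 inj image by (auto simp: distinct_map)
qed

end
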